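(* Let $k\in\{3,4\}$. If $G$ is a connected $k$-colorable graph of order $n$ and of minimum degree at least $\delta\ge 1$, then \[ \operatorname{diam}(G)\le\left(3-\frac{2}{k}\right)\frac{n}{\delta}-1 . \]
   Context: $\operatorname{diam}(G)$ denotes the diameter of $G$ (the maximum distance between two vertices). A graph is $k$-colorable if it admits a proper vertex coloring with at most $k$ colors. *)

theory Defs
  imports "Graph_Theory.Graph_Theory"
begin

text \<open>
  Finite simple graphs are the locale \<^locale>\<open>graph\<close>: finite, loop-free, symmetric
  digraphs without multiple arcs. An edge is a pair of opposite arcs, so the degree of a
  vertex is its \<^const>\<open>out_degree\<close>.
\<close>

definition min_degree :: "('a, 'b) pre_digraph \<Rightarrow> nat" where
  "min_degree G = Min (out_degree G ` verts G)"

definition colorable :: "('a, 'b) pre_digraph \<Rightarrow> nat \<Rightarrow> bool" where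
  "colorable G k \<longleftrightarrow>
     (\<exists>c :: 'a \<Rightarrow> nat. c ` verts G \<subseteq> {..<k} \<and> (\<forall>u v. u \<rightarrow>\<^bsub>G\<^esub> v \<longrightarrow> c u \<noteq> c v))"

text \<open>
  The shortest-path cost \<^const>\<open>wf_digraph.\<mu>\<close> with unit arc costs is the usual distance,
  with value \<open>\<infinity>\<close> if there is no walk; for a connected finite graph the supremum below is
  a maximum.
\<close>

definition graph_dist :: "('a, 'b) pre_digraph \<Rightarrow> 'a \<Rightarrow> 'a \<Rightarrow> ereal" where
  "graph_dist G u v = wf_digraph.\<mu> G (\<lambda>_. 1) u v"

definition graph_diam :: "('a, 'b) pre_digraph \<Rightarrow> ereal" where
  "graph_diam G = (SUP (u, v) \<in> verts G \<times> verts G. graph_dist G u v)"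

end

theory Submission
  imports Defs
begin

text \<open>
  Split the graph into the \<open>m\<close> distance layers of a vertex, and let \<open>S i\<close> be the set of colors in
  layer \<open>i\<close>. Every color \<open>c \<in> S i\<close> gives a linear constraint: the layers \<open>i - 1\<close>, \<open>i\<close>, \<open>i + 1\<close>
  contain at least \<open>\<delta>\<close> vertices of colors other than \<open>c\<close>. By linear programming duality it suffices
  to find weights \<open>y i c \<ge> 0\<close>, supported on \<open>c \<in> S i\<close> and of total \<open>m\<close>, such that for all \<open>c \<in> S j\<close>
  the colors other than \<open>c\<close> have weight at most \<open>3 - 2 / k\<close> in the layers \<open>j - 1\<close>, \<open>j\<close>, \<open>j + 1\<close>
  together.

  If every layer has total weight \<open>1\<close>, this asks that \<open>c\<close> itself has weight at least \<open>2 / k\<close> in these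
  three layers. Suitable probability weights are easily described, except in a layer with \<open>k - 1\<close>
  colors not occurring in the adjacent layers; both of these are then monochromatic of the same
  color. Such peaks are repaired by moving weight \<open>1 - 2 / k\<close> into a peak from the next layer, for
  every other peak in a run of peaks at distance two.
\<close>

section \<open>Weights on a single layer\<close>

text \<open>The weights on a layer with color set \<open>B\<close>; \<open>N\<close> is the set of colors in the adjacent layers.\<close>

definition color_weight :: "nat \<Rightarrow> 'c set \<Rightarrow> 'c set \<Rightarrow> 'c \<Rightarrow> real" where
  "color_weight k N B c =
     (if c \<notin> B then 0
      else if 2 * card B \<le> k then 1 / card B
      else if c \<in> N then max 0 (1 - 2 * card (B - N) / k) / card (B \<inter> N)
      else min (2 / k) (1 / card (B - N)))"

lemma color_weight_outside [simp]: "c \<notin> B \<Longrightarrow> color_weight k N B c = 0"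
  by (simp add: color_weight_def)

lemma color_weight_nonneg: "0 \<le> color_weight k N B c"
  by (simp add: color_weight_def)

text \<open>When \<open>B\<close> has more than k/2 colors, each color outside \<open>N\<close>
  takes 2/k, or an equal share of 1 if that is less, and the colors in \<open>N\<close> split the
  rest. If \<open>B\<close> has no color in \<open>N\<close>, the equal share is the smaller one,
  because \<open>card B\<close> exceeds k/2.\<close>

lemma sum_color_weight:
  assumes "finite B" and "B \<noteq> {}" and "0 < k"
  shows "(\<Sum>c\<in>B. color_weight k N B c) = 1"
proof (cases "2 * card B \<le> k")
  case True
  then have "(\<Sum>c\<in>B. color_weight k N B c) = (\<Sum>c\<in>B. 1 / card B)"
    by (intro sum.cong) (auto simp: color_weight_def)
  with assms show ?thesis by simp
next
  case False
  define u t where "u = card (B - N)" and "t = card (B \<inter> N)"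
  have B: "card B = u + t"
    unfolding u_def t_def using assms by (metis add.commute card_Int_Diff)
  have "(\<Sum>c\<in>B. color_weight k N B c) =
      (\<Sum>c\<in>B - N. color_weight k N B c) + (\<Sum>c\<in>B \<inter> N. color_weight k N B c)"
    using assms by (subst sum.union_disjoint[symmetric]) (auto intro: sum.cong)
  also have "(\<Sum>c\<in>B - N. color_weight k N B c) = u * min (2 / k) (1 / u)"
    using False by (simp add: color_weight_def u_def)
  also have "(\<Sum>c\<in>B \<inter> N. color_weight k N B c) = t * (max 0 (1 - 2 * u / k) / t)"
    using False by (simp add: color_weight_def u_def t_def)
  also have "u * min (2 / k) (1 / u) + t * (max 0 (1 - real (2 * u) / k) / t) = 1"
  proof (cases "u = 0")
    case True
    with B assms show ?thesis by (auto simp: card_eq_0_iff)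
  next
    case u: False
    show ?thesis
    proof (cases "t = 0")
      case True
      with False B have "real k < real (2 * u)" by (simp only: of_nat_less_iff) simp
      with True u \<open>0 < k\<close> show ?thesis by (auto simp: min_def field_simps)
    next
      case False
      with u \<open>0 < k\<close> show ?thesis by (auto simp: min_def max_def field_simps)
    qed
  qed
  finally show ?thesis .
qed

text \<open>
  If \<open>B\<close> and \<open>C\<close> have more than \<open>k / 2\<close> colors each, the worst case is \<open>N = C\<close>, \<open>M = B\<close> and
  \<open>B \<union> C = K\<close>, where the two weights add up to exactly \<open>2 / k\<close>.
\<close>

lemma color_weight_shared:
  assumes "finite K" and "card K = k" and "B \<subseteq> K" and "C \<subseteq> K" and "C \<subseteq> N" and "B \<subseteq> M"
    and c: "c \<in> B" "c \<in> C"
  shows "2 / k \<le> color_weight k N B c + color_weight k M C c"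
proof -
  have fin: "finite B" "finite C" using assms finite_subset by blast+
  have pos: "0 < card B" "0 < card C" using c fin by (auto simp: card_gt_0_iff)
  have le: "card B \<le> k" "card C \<le> k" using assms card_mono by blast+
  have small: "2 / k \<le> color_weight k X A c" if "2 * card A \<le> k" "c \<in> A" "0 < card A" for A X
    using that by (simp add: color_weight_def field_simps)
  consider "2 * card B \<le> k" | "2 * card C \<le> k" | "k < 2 * card B" "k < 2 * card C" by linarith
  then show ?thesis
  proof cases
    case 1
    then show ?thesis using small[of B N] c pos color_weight_nonneg[of k M C c] by linarith
  next
    case 2
    then show ?thesis using small[of C M] c pos color_weight_nonneg[of k N B c] by linarith
  next
    case 3
    \<comment> \<open>\<open>A - X\<close> lies in \<open>K - A'\<close>, so \<open>u\<close> is at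
      most \<open>k - card A'\<close>; the left side is \<open>(1 - 2 * u / k) / t\<close> at this
      extreme value. Exchanging \<open>A\<close> and \<open>A'\<close> keeps the
      denominator.\<close>
    have bound: "(2 * real (card A') - k) / (k * (card A + card A' - real k)) \<le> color_weight k X A c"
      if "A \<subseteq> K" "A' \<subseteq> K" "A' \<subseteq> X" "c \<in> A" "c \<in> A'" "k < 2 * card A" "k < 2 * card A'" for A A' X
    proof -
      define u t where "u = card (A - X)" and "t = card (A \<inter> X)"
      have "finite A" "finite A'" using that assms finite_subset by blast+
      have A: "card A = u + t"
        unfolding u_def t_def using \<open>finite A\<close> by (metis add.commute card_Int_Diff)
      have "u \<le> card (K - A')" unfolding u_def using that assms by (intro card_mono) auto
      then have u: "u + card A' \<le> k"
        using that assms \<open>finite A'\<close> card_mono[of K A'] by (simp add: card_Diff_subset)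
      have "c \<in> A \<inter> X" using that by auto
      then have "0 < t" unfolding t_def using \<open>finite A\<close> by (auto simp: card_gt_0_iff)
      have k: "0 < k" using u that \<open>finite A'\<close> by (auto simp: card_gt_0_iff)
      have "(2 * real (card A') - k) / (k * (card A + card A' - real k)) \<le> (1 - 2 * u / k) / t"
      proof -
        have d: "0 < card A + card A' - real k" using that by linarith
        \<comment> \<open>This product is the right side minus the left side of the cross-multiplied
          inequality that follows.\<close>
        have "0 \<le> (real k - u - card A') * (2 * card A - real k)"
          using u that by (intro mult_nonneg_nonneg) linarith+
        then have "(2 * real (card A') - k) * t \<le> (k - 2 * real u) * (card A + card A' - real k)"
          unfolding A by (simp add: algebra_simps)
        then have "(2 * real (card A') - k) / (card A + card A' - real k) \<le> (k - 2 * real u) / t"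
          using d \<open>0 < t\<close> by (simp add: divide_le_eq le_divide_eq field_simps)
        then have "(2 * real (card A') - k) / (card A + card A' - real k) / k \<le> (k - 2 * real u) / t / k"
          using k by (intro divide_right_mono) auto
        then show ?thesis using k by (simp add: field_simps)
      qed
      also have "\<dots> \<le> color_weight k X A c"
        using that by (auto simp: color_weight_def u_def t_def intro: divide_right_mono)
      finally show ?thesis .
    qed
    have k: "0 < k" using pos le by linarith
    define d where "d = card B + card C - real k"
    have "0 < d" unfolding d_def using 3 by linarith
    have "2 / k = (2 * d) / (k * d)" using \<open>0 < d\<close> by simp
    also have "\<dots> = (2 * real (card C) - k) / (k * d) + (2 * real (card B) - k) / (k * d)"
      unfolding d_def by (simp add: add_divide_distrib[symmetric] algebra_simps)
    also have "\<dots> \<le> color_weight k N B c + color_weight k M C c"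
      using bound[of B C N] bound[of C B M] assms 3 unfolding d_def
      by (intro add_mono) (auto simp: add.commute)
    finally show ?thesis .
  qed
qed

lemma color_weight_private:
  assumes "c \<in> B" "c \<notin> N" and "finite B" and "2 * card (B - N) \<le> k"
  shows "2 / k \<le> color_weight k N B c"
proof -
  have "0 < card (B - N)" "0 < card B" using assms by (auto simp: card_gt_0_iff)
  moreover have "real (2 * a) \<le> real k" if "2 * a \<le> k" for a
    using that by (simp only: of_nat_le_iff)
  ultimately show ?thesis using assms
    by (auto simp: color_weight_def field_simps)
qed

section \<open>Boosting of peaks and dual feasibility\<close>

text \<open>Layers are numbered from 1, so that the first layer also has a predecessor, the empty layer 0.\<close>

locale color_layers =
  fixes K :: "'c set" and S :: "nat \<Rightarrow> 'c set"
  assumes finite_colors: "finite K" and card_colors: "card K = 3 \<or> card K = 4"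
    and subset_colors: "S i \<subseteq> K" and empty_0: "S 0 = {}"
begin

text \<open>The color \<open>d\<close> may or may not occur in layer \<open>i\<close> itself; what
  matters is that all other colors of \<open>K\<close> occur there.\<close>

definition peak :: "nat \<Rightarrow> bool" where
  "peak i \<longleftrightarrow> (\<exists>d. S (i - 1) = {d} \<and> S (Suc i) = {d} \<and> card (S i - {d}) = card K - 1)"

text \<open>In a run of peaks at distance two, the first, third, fifth and so on are boosted. Layers
  0 and 1 are never peaks, because layer 0 is empty.\<close>

fun boosted :: "nat \<Rightarrow> bool" where
  "boosted 0 \<longleftrightarrow> False"
| "boosted (Suc 0) \<longleftrightarrow> False"
| "boosted (Suc (Suc i)) \<longleftrightarrow> peak (Suc (Suc i)) \<and> \<not> boosted i"

definition factor :: "nat \<Rightarrow> real" where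
  "factor i = 1 + (1 - 2 / card K) * (of_bool (boosted i) - of_bool (boosted (i - 1)))"

definition base_weight :: "nat \<Rightarrow> 'c \<Rightarrow> real" where
  "base_weight i = color_weight (card K) (S (i - 1) \<union> S (Suc i)) (S i)"

definition dual_weight :: "nat \<Rightarrow> 'c \<Rightarrow> real" where
  "dual_weight i c = factor i * base_weight i c"

text \<open>The contribution of layer \<open>i\<close> to the dual constraint of a vertex of color
  \<open>c\<close>.\<close>

definition load :: "nat \<Rightarrow> 'c \<Rightarrow> real" where
  "load i c = (\<Sum>b\<in>K - {c}. dual_weight i b)"

text \<open>The load before the factor is applied; \<open>of_bool\<close> is the total base weight,
  so an empty layer contributes 0.\<close>

definition co_weight :: "nat \<Rightarrow> 'c \<Rightarrow> real" where
  "co_weight i c = of_bool (S i \<noteq> {}) - base_weight i c"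

lemma finite_layer: "finite (S i)"
  using finite_colors subset_colors finite_subset by blast

lemma sum_base_weight: "(\<Sum>c\<in>K. base_weight i c) = of_bool (S i \<noteq> {})"
proof -
  have "(\<Sum>c\<in>K. base_weight i c) = (\<Sum>c\<in>S i. base_weight i c)"
    using finite_colors subset_colors
    by (intro sum.mono_neutral_right) (auto simp: base_weight_def)
  moreover have "0 < card K" using card_colors by auto
  ultimately show ?thesis
    using sum_color_weight[OF finite_layer] by (cases "S i = {}") (simp_all add: base_weight_def)
qed

lemma sum_dual_weight: "(\<Sum>c\<in>K. dual_weight i c) = factor i * of_bool (S i \<noteq> {})"
  by (simp add: dual_weight_def sum_distrib_left[symmetric] sum_base_weight)

lemma base_weight_nonneg: "0 \<le> base_weight i c"
  by (simp add: base_weight_def color_weight_nonneg)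

lemma co_weight_eq_sum: "c \<in> K \<Longrightarrow> co_weight i c = (\<Sum>b\<in>K - {c}. base_weight i b)"
  using sum_base_weight[of i] sum.remove[OF finite_colors, of c "base_weight i"]
  by (simp add: co_weight_def)

lemma load_eq: "c \<in> K \<Longrightarrow> load i c = factor i * co_weight i c"
  by (simp add: load_def dual_weight_def sum_distrib_left co_weight_eq_sum)

lemma co_weight_nonneg: "c \<in> K \<Longrightarrow> 0 \<le> co_weight i c"
  by (simp add: co_weight_eq_sum base_weight_nonneg sum_nonneg)

lemma co_weight_le_1: "co_weight i c \<le> 1"
  using base_weight_nonneg[of i c] by (simp add: co_weight_def)

lemma co_weight_singleton: "S i = {c} \<Longrightarrow> co_weight i c = 0"
  using card_colors by (auto simp: co_weight_def base_weight_def color_weight_def)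

lemma boosted_imp_peak: "boosted i \<Longrightarrow> peak i"
  by (cases i rule: boosted.cases) auto

lemma peak_not_singleton:
  assumes "peak i"
  shows "S i \<noteq> {c}"
proof
  assume "S i = {c}"
  moreover obtain d where "card (S i - {d}) = card K - 1"
    using assms by (auto simp: peak_def)
  ultimately have "card K - 1 \<le> 1"
    using card_mono[of "{c}" "{c} - {d}"] by auto
  then show False using card_colors by auto
qed

lemma peak_not_adjacent: "peak i \<Longrightarrow> \<not> peak (Suc i)"
  using peak_not_singleton[of i] by (auto simp: peak_def)

lemma factor_nonneg: "0 \<le> factor i"
  using card_colors by (auto simp: factor_def)

lemma factor_le: "factor i \<le> 1 + (1 - 2 / card K) * of_bool (boosted i)"
  using card_colors by (auto simp: factor_def)

lemma factor_after_boosted: "boosted i \<Longrightarrow> factor (Suc i) = 2 / card K"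
  using boosted_imp_peak[of i] boosted_imp_peak[of "Suc i"] peak_not_adjacent[of i]
  by (auto simp: factor_def)

lemma load_le:
  assumes "c \<in> K"
  shows "load i c \<le> (1 + (1 - 2 / card K) * of_bool (boosted i)) * co_weight i c"
  using assms by (simp only: load_eq mult_right_mono[OF factor_le] co_weight_nonneg)

lemma load_le_regular: "c \<in> K \<Longrightarrow> \<not> boosted i \<Longrightarrow> load i c \<le> co_weight i c"
  using load_le[of c i] by simp

lemma load_le_boosted:
  assumes "c \<in> K"
  shows "load i c \<le> 2 - 2 / card K"
proof -
  have "(1 + (1 - 2 / card K) * of_bool (boosted i)) * co_weight i c \<le> (2 - 2 / card K) * 1"
    using card_colors co_weight_le_1 assms by (intro mult_mono) (auto simp: co_weight_nonneg)
  from order_trans[OF load_le[OF assms] this] show ?thesis by simp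
qed

lemma load_after_boosted: "c \<in> K \<Longrightarrow> boosted i \<Longrightarrow> load (Suc i) c \<le> 2 / card K"
  using co_weight_le_1[of "Suc i" c] mult_left_mono[of "co_weight (Suc i) c" 1 "2 / card K"]
  by (simp add: load_eq factor_after_boosted)

text \<open>The \<open>card K - 1\<close> colors other than \<open>d\<close> divide the whole weight
  equally. Each gets less than 2/k and is absent from the adjacent layers: this is the deficit that
  boosting repairs.\<close>

lemma peak_co_weight:
  assumes "S (i - 1) = {d}" and "S (Suc i) = {d}" and "card (S i - {d}) = card K - 1"
    and "c \<in> S i" and "c \<noteq> d"
  shows "co_weight i c = 1 - 1 / (card K - 1)"
proof -
  have "card (S i - {d}) \<le> card (S i)"
    using finite_layer by (intro card_mono) auto
  then have "\<not> 2 * card (S i) \<le> card K" using assms(3) card_colors by linarith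
  moreover have "S (i - 1) \<union> S (Suc i) = {d}" using assms(1,2) by simp
  ultimately have "base_weight i c = min (2 / card K) (1 / (card K - 1))"
    using assms(3-5) unfolding base_weight_def color_weight_def by simp
  also have "\<dots> = 1 / (card K - 1)"
    using card_colors by (elim disjE) simp_all
  finally have "base_weight i c = 1 / (card K - 1)" .
  moreover have "S i \<noteq> {}" using assms by auto
  ultimately show ?thesis by (simp add: co_weight_def)
qed

text \<open>A color that recurs in an adjacent layer has enough weight in these two layers together.
  Any other color falls short only if more than k/2 colors of layer \<open>j\<close> are missing
  next to it, which forces a peak.\<close>

lemma regular_base_weight:
  assumes "0 < j" and "c \<in> S j" and "\<not> peak j" and "S (j - 1) \<noteq> {}" and "S (Suc j) \<noteq> {}"
  shows "2 / card K \<le> base_weight (j - 1) c + base_weight j c + base_weight (Suc j) c"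
proof -
  note nonneg = base_weight_nonneg[of "j - 1" c] base_weight_nonneg[of j c]
    base_weight_nonneg[of "Suc j" c]
  let ?N = "S (j - 1) \<union> S (Suc j)"
  consider "c \<in> S (j - 1)" | "c \<in> S (Suc j)" | "c \<notin> ?N" by blast
  then show ?thesis
  proof cases
    case 1
    have "2 / card K \<le> base_weight j c + base_weight (j - 1) c"
      unfolding base_weight_def using 1 assms subset_colors finite_colors
      by (intro color_weight_shared[of K]) auto
    with nonneg show ?thesis by linarith
  next
    case 2
    have "2 / card K \<le> base_weight j c + base_weight (Suc j) c"
      unfolding base_weight_def using 2 assms subset_colors finite_colors
      by (intro color_weight_shared[of K]) auto
    with nonneg show ?thesis by linarith
  next
    case 3
    have "2 * card (S j - ?N) \<le> card K"
    proof (rule ccontr)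
      assume *: "\<not> ?thesis"
      have "card (S j - ?N) + card ?N = card (S j - ?N \<union> ?N)"
        using finite_layer by (intro card_Un_disjoint[symmetric]) auto
      also have "\<dots> \<le> card K"
        using subset_colors by (intro card_mono finite_colors) blast
      finally have "card (S j - ?N) + card ?N \<le> card K" .
      moreover have "0 < card ?N"
        using assms finite_layer by (simp add: card_gt_0_iff)
      \<comment> \<open>Here 3 or 4 colors matter: a number above k/2 and at most k - 1 must be k -
        1.\<close>
      ultimately have 1: "card ?N = 1" "card (S j - ?N) = card K - 1"
        using * card_colors by linarith+
      then obtain d where d: "?N = {d}" by (auto simp: card_1_singleton_iff)
      have "S (j - 1) \<subseteq> {d}" "S (Suc j) \<subseteq> {d}" unfolding d[symmetric] by auto
      with assms(4,5) have "S (j - 1) = {d}" "S (Suc j) = {d}" by (auto dest: subset_singletonD)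
      with 1 d have "peak j" unfolding peak_def by metis
      with assms(3) show False by simp
    qed
    then have "2 / card K \<le> base_weight j c"
      unfolding base_weight_def using 3 assms finite_layer by (intro color_weight_private) auto
    with nonneg show ?thesis by linarith
  qed
qed

text \<open>
  Next to a monochromatic layer at most one peak is boosted, which is just affordable:
  \<open>(2 - 2 / k) + 1 = 3 - 2 / k\<close>. Conversely each peak is boosted or preceded by a weakened layer.
\<close>

lemma dual_feasible:
  assumes j: "0 < j" and c: "c \<in> S j"
  shows "load (j - 1) c + load j c + load (Suc j) c \<le> 3 - 2 / card K"
proof -
  have cK: "c \<in> K" using c subset_colors by blast
  note regular = load_le_regular[OF cK] and boost = load_le_boosted[OF cK]
    and after = load_after_boosted[OF cK] and le_1 = co_weight_le_1[of _ c]
  define q x :: real where "q = 2 / card K" and "x = 1 / (card K - 1)"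
  \<comment> \<open>For a color other than \<open>d\<close>, the bound on 2q settles an unboosted
    peak, with loads at most q, 1 - x and 1; the equation settles a boosted one, with loads at most
    1, 2 - 2q and q.\<close>
  have q: "q \<le> 1" "2 * q \<le> 1 + x" "(2 - q) * (1 - x) = 2 - 2 * q"
    using card_colors unfolding q_def x_def by (elim disjE; simp)+
  have "load (j - 1) c + load j c + load (Suc j) c \<le> 3 - q"
  proof (cases "peak j")
    case True
    then obtain d where d: "S (j - 1) = {d}" "S (Suc j) = {d}" "card (S j - {d}) = card K - 1"
      unfolding peak_def by auto
    have nb: "\<not> boosted (j - 1)" "\<not> boosted (Suc j)"
      using d boosted_imp_peak peak_not_singleton by blast+
    show ?thesis
    proof (cases "c = d")
      case True
      with d have "co_weight (j - 1) c = 0" "co_weight (Suc j) c = 0"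
        by (simp_all add: co_weight_singleton)
      with regular[OF nb(1)] regular[OF nb(2)] boost[of j] show ?thesis
        unfolding q_def by linarith
    next
      case False
      with d c have co: "co_weight j c = 1 - x"
        unfolding x_def by (intro peak_co_weight)
      show ?thesis
      proof (cases "boosted j")
        case True
        then have "load j c \<le> (2 - q) * co_weight j c"
          using load_le[OF cK, of j] unfolding q_def by simp
        then have "load j c \<le> 2 - 2 * q" unfolding co q .
        with after[OF True] regular[OF nb(1)] le_1[of "j - 1"] show ?thesis
          unfolding q_def by linarith
      next
        case False
        have "j \<noteq> 1" using d empty_0 by auto
        with j obtain i where i: "j = Suc (Suc i)" by (metis One_nat_def gr0_conv_Suc neq0_conv)
        with False \<open>peak j\<close> have "boosted i" by simp
        from after[OF this] have "load (j - 1) c \<le> q" by (simp add: i q_def)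
        with regular[OF False] regular[OF nb(2)] le_1[of "Suc j"] co q(2) show ?thesis
          by linarith
      qed
    qed
  next
    case False
    then have nb: "\<not> boosted j" using boosted_imp_peak by blast
    show ?thesis
    proof (cases "boosted (j - 1) \<or> boosted (Suc j)")
      case True
      then have "\<exists>d. S j = {d}"
        using j boosted_imp_peak[of "j - 1"] boosted_imp_peak[of "Suc j"]
        by (auto simp: peak_def)
      with c have "S j = {c}" by auto
      then have "load j c \<le> 0" using regular[OF nb] co_weight_singleton[of j c] by simp
      moreover have "\<not> boosted (j - 1) \<or> \<not> boosted (Suc j)"
        using j by (cases j) auto
      then have "load (j - 1) c \<le> 1 \<or> load (Suc j) c \<le> 1"
        using regular le_1 order_trans by blast
      ultimately show ?thesis
        using boost[of "j - 1"] boost[of "Suc j"] unfolding q_def by linarith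
    next
      case nb': False
      have "co_weight (j - 1) c + co_weight j c + co_weight (Suc j) c \<le> 3 - q"
      \<comment> \<open>An empty neighboring layer contributes 0 and the other two layers at most
        2.\<close>
      proof (cases "S (j - 1) = {} \<or> S (Suc j) = {}")
        case True
        then have "co_weight (j - 1) c \<le> 0 \<or> co_weight (Suc j) c \<le> 0"
          using base_weight_nonneg[of _ c] by (elim disjE) (simp_all add: co_weight_def)
        with le_1[of "j - 1"] le_1[of j] le_1[of "Suc j"] q(1) show ?thesis by linarith
      next
        case nonempty: False
        with regular_base_weight[OF j c False] c show ?thesis
          by (auto simp: co_weight_def q_def)
      qed
      with regular[OF nb] regular[of "j - 1"] regular[of "Suc j"] nb' show ?thesis by simp
    qed
  qed
  then show ?thesis unfolding q_def .
qed

text \<open>The transfers between consecutive layers telescope, and none leaves layer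
  \<open>m\<close>: it is no peak, as an empty layer follows.\<close>

lemma sum_factor:
  assumes "S (Suc m) = {}"
  shows "(\<Sum>i=1..m. factor i) = m"
proof -
  have "(\<Sum>i=1..n. factor i) = n + (1 - 2 / card K) * of_bool (boosted n)" for n
    by (induction n) (simp_all add: factor_def algebra_simps)
  moreover have "\<not> boosted m" using assms boosted_imp_peak[of m] by (auto simp: peak_def)
  ultimately show ?thesis by simp
qed

end

section \<open>Weak duality\<close>

text \<open>Each degree condition is multiplied by its dual weight; after exchanging the sums, a
  vertex counts with the load of the three layers around it.\<close>

lemma layered_coloring_bound:
  fixes l :: "'a \<Rightarrow> nat" and col :: "'a \<Rightarrow> 'c"
  assumes V: "finite V" and K: "finite K" "card K = 3 \<or> card K = 4" and col: "col ` V \<subseteq> K"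
    and l: "l ` V = {1..m}"
    and deg: "\<And>v. v \<in> V \<Longrightarrow>
      \<delta> \<le> card {w \<in> V. l w \<in> {l v - 1..Suc (l v)} \<and> col w \<noteq> col v}"
  shows "real m * real \<delta> \<le> (3 - 2 / card K) * card V"
proof -
  define S where "S i = col ` {v \<in> V. l v = i}" for i
  have l_pos: "0 < l v" if "v \<in> V" for v
    using l that
    by (metis atLeastAtMost_iff imageI less_eq_Suc_le One_nat_def)
  interpret color_layers K S
    using K col l_pos by unfold_locales (auto simp: S_def)
  have "S i \<noteq> {} \<longleftrightarrow> i \<in> l ` V" for i by (auto simp: S_def)
  then have S_nonempty: "S i \<noteq> {} \<longleftrightarrow> 1 \<le> i \<and> i \<le> m" for i by (simp add: l)
  then have S_top: "S (Suc m) = {}" using not_less_eq_eq by blast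
  have dual_nonneg: "0 \<le> dual_weight i b" for i b
    by (simp add: dual_weight_def factor_nonneg base_weight_nonneg)
  define near where "near i w \<longleftrightarrow> l w \<in> {i - 1..Suc i}" for i w
  have "real m * \<delta> = (\<Sum>i=1..m. \<Sum>b\<in>K. dual_weight i b * \<delta>)"
    using sum_factor[OF S_top] by (simp add: sum_distrib_right[symmetric] sum_dual_weight S_nonempty)
  also have "\<dots> \<le> (\<Sum>i=1..m. \<Sum>b\<in>K. \<Sum>w\<in>V. if near i w \<and> col w \<noteq> b then dual_weight i b else 0)"
  proof (intro sum_mono)
    fix i b
    have "dual_weight i b * \<delta> \<le> dual_weight i b * card {w \<in> V. near i w \<and> col w \<noteq> b}"
    \<comment> \<open>If color \<open>b\<close> is missing from layer \<open>i\<close>, no vertex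
      supplies the constraint, but then the weight is 0.\<close>
    proof (cases "b \<in> S i")
      case True
      then obtain v where "v \<in> V" "l v = i" "col v = b" by (auto simp: S_def)
      with deg[of v] show ?thesis
        by (intro mult_left_mono) (simp_all add: near_def dual_nonneg)
    qed (simp add: dual_weight_def base_weight_def)
    also have "\<dots> = (\<Sum>w\<in>V. if near i w \<and> col w \<noteq> b then dual_weight i b else 0)"
      using V by (simp add: sum.If_cases Int_def mult.commute)
    finally show "dual_weight i b * \<delta> \<le> \<dots>" .
  qed
  also have "\<dots> = (\<Sum>i=1..m. \<Sum>w\<in>V. \<Sum>b\<in>K. if near i w \<and> col w \<noteq> b then dual_weight i b else 0)"
    by (intro sum.cong refl sum.swap)
  also have "\<dots> = (\<Sum>w\<in>V. \<Sum>i=1..m. \<Sum>b\<in>K. if near i w \<and> col w \<noteq> b then dual_weight i b else 0)"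
    by (rule sum.swap)
  also have "\<dots> \<le> (\<Sum>w\<in>V. 3 - 2 / card K)"
  proof (rule sum_mono)
    fix w assume w: "w \<in> V"
    have load: "(\<Sum>b\<in>K. if near i w \<and> col w \<noteq> b then dual_weight i b else 0) =
        (if near i w then load i (col w) else 0)" for i
      unfolding load_def using K by (auto intro!: sum.mono_neutral_cong_right split: if_splits)
    have nonneg: "0 \<le> load i (col w)" for i
      unfolding load_def by (intro sum_nonneg dual_nonneg)
    obtain j where j: "l w = Suc j" using l_pos[OF w] gr0_conv_Suc by blast
    have "(\<Sum>i=1..m. if near i w then load i (col w) else 0) =
        (\<Sum>i\<in>{i \<in> {1..m}. near i w}. load i (col w))"
      by (rule sum.inter_filter[symmetric]) simp
    \<comment> \<open>Adding layer 0 or \<open>Suc m\<close> is harmless, as loads are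
      nonnegative.\<close>
    also have "\<dots> \<le> (\<Sum>i\<in>{j, Suc j, Suc (Suc j)}. load i (col w))"
      by (intro sum_mono2) (auto simp: near_def j nonneg)
    also have "\<dots> \<le> 3 - 2 / card K"
      using dual_feasible[of "Suc j" "col w"] w j by (simp add: S_def add.assoc)
    finally show "(\<Sum>i=1..m. \<Sum>b\<in>K. if near i w \<and> col w \<noteq> b then dual_weight i b else 0) \<le> 3 - 2 / card K"
      unfolding load .
  qed
  finally show ?thesis by (simp add: mult.commute)
qed

section \<open>Distance layers of a graph\<close>

lemma relpow_Least_step:
  assumes "(x, v) \<in> R\<^sup>*" and "(v, w) \<in> R"
  shows "(LEAST n. (x, w) \<in> R ^^ n) \<le> Suc (LEAST n. (x, v) \<in> R ^^ n)"
proof -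
  have "(x, v) \<in> R ^^ (LEAST n. (x, v) \<in> R ^^ n)"
    using assms(1) by (metis LeastI rtrancl_imp_relpow)
  with assms(2) have "(x, w) \<in> R ^^ Suc (LEAST n. (x, v) \<in> R ^^ n)" by auto
  then show ?thesis by (rule Least_le)
qed

text \<open>The last step of a shortest walk to \<open>v\<close> starts at such a \<open>u\<close>;
  by \<open>relpow_Least_step\<close>, \<open>u\<close> cannot be closer than
  \<open>i\<close>.\<close>

lemma relpow_Least_pred:
  assumes "(x, v) \<in> R\<^sup>*" and "(LEAST n. (x, v) \<in> R ^^ n) = Suc i"
  shows "\<exists>u. (u, v) \<in> R \<and> (LEAST n. (x, u) \<in> R ^^ n) = i"
proof -
  have "(x, v) \<in> R ^^ Suc i" using assms by (metis LeastI rtrancl_imp_relpow)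
  then obtain u where u: "(x, u) \<in> R ^^ i" "(u, v) \<in> R" by auto
  then have "(x, u) \<in> R\<^sup>*" by (auto simp: rtrancl_power)
  with relpow_Least_step u(2) assms(2) have "i \<le> (LEAST n. (x, u) \<in> R ^^ n)" by fastforce
  moreover have "(LEAST n. (x, u) \<in> R ^^ n) \<le> i" using u(1) by (rule Least_le)
  ultimately show ?thesis using u(2) by auto
qed

text \<open>Serves to number the nonempty layers from 1 without gaps.\<close>

lemma finite_downward_closed_eq_atLeastAtMost:
  fixes A :: "nat set"
  assumes "finite A" and "A \<noteq> {}" and "0 \<notin> A" and step: "\<And>i. 0 < i \<Longrightarrow> Suc i \<in> A \<Longrightarrow> i \<in> A"
  shows "A = {1..Max A}"
proof
  show "A \<subseteq> {1..Max A}" using assms by (auto simp: Suc_le_eq intro: gr0I)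
  show "{1..Max A} \<subseteq> A"
  proof
    fix i assume "i \<in> {1..Max A}"
    then have "i \<le> Max A" "0 < i" by auto
    then show "i \<in> A"
    proof (induction rule: inc_induct)
      case base
      show ?case using assms(1,2) by (rule Max_in)
    next
      case (step n)
      then show ?case using assms(4) by blast
    qed
  qed
qed

text \<open>Turns the relational distance into a walk, whose cost bounds
  \<open>graph_dist\<close>.\<close>

lemma (in wf_digraph) relpow_arcs_ends_imp_awalk:
  "(u, v) \<in> arcs_ends G ^^ n \<Longrightarrow> u \<in> verts G \<Longrightarrow> \<exists>p. awalk u p v \<and> length p = n"
proof (induction n arbitrary: u)
  case 0
  then show ?case by (auto simp: awalk_Nil_iff)
next
  case (Suc n)
  then obtain w where w: "(u, w) \<in> arcs_ends G" "(w, v) \<in> arcs_ends G ^^ n"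
    by (blast elim: relpow_Suc_E2)
  then obtain e where e: "e \<in> arcs G" "tail G e = u" "head G e = w" by (auto simp: arcs_ends_conv)
  with Suc.IH[OF w(2)] obtain p where "awalk w p v" "length p = n" by auto
  with e have "awalk u (e # p) v" "length (e # p) = Suc n" by (auto simp: awalk_Cons_iff)
  then show ?case by blast
qed

lemma (in digraph) out_degree_eq_card_neighbors: "out_degree G v = card {w. v \<rightarrow>\<^bsub>G\<^esub> w}"
proof -
  have "{w. v \<rightarrow>\<^bsub>G\<^esub> w} = head G ` out_arcs G v" by (auto simp: arcs_ends_conv)
  moreover have "inj_on (head G) (out_arcs G v)"
    by (auto intro!: inj_onI no_multi_arcs simp: arc_to_ends_def)
  ultimately show ?thesis by (simp add: out_degree_def card_image)
qed

theorem theorem1p6: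
  fixes G :: "('a, 'b) pre_digraph" and k n \<delta> :: nat
  assumes "k \<in> {3, 4}"
    and "graph G"
    and "Digraph_Component.connected G"
    and "colorable G k"
    and "card (verts G) = n"
    and "\<delta> \<ge> 1"
    and "min_degree G \<ge> \<delta>"
  shows "graph_diam G \<le> ereal ((3 - 2 / real k) * (real n / real \<delta>) - 1)"
proof -
  interpret graph G by fact
  obtain c :: "'a \<Rightarrow> nat" where c: "c ` verts G \<subseteq> {..<k}" "\<And>u v. u \<rightarrow>\<^bsub>G\<^esub> v \<Longrightarrow> c u \<noteq> c v"
    using assms by (auto simp: colorable_def)
  have "graph_dist G x y \<le> ereal ((3 - 2 / real k) * (real n / real \<delta>) - 1)"
    if x: "x \<in> verts G" and y: "y \<in> verts G" for x y
  proof -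
    let ?R = "arcs_ends G"
    define d where "d v = (LEAST n. (x, v) \<in> ?R ^^ n)" for v
    \<comment> \<open>The shift puts \<open>x\<close> in layer 1 and leaves layer 0 empty. It yields
      the final -1, since \<open>d y + 1\<close> is at most \<open>m\<close>.\<close>
    define l where "l v = Suc (d v)" for v
    have reach: "(x, v) \<in> ?R\<^sup>*" if "v \<in> verts G" for v
    proof -
      have "x \<rightarrow>\<^sup>*\<^bsub>mk_symmetric G\<^esub> v"
        using assms(3) x that by (auto simp: connected_def)
      then have "x \<rightarrow>\<^sup>*\<^bsub>G\<^esub> v" using reachable_mk_symmetric_eq[OF sym_arcs] by simp
      then show ?thesis by (rule reachable_rtranclI)
    qed
    have step: "l w \<le> Suc (l v)" if "v \<rightarrow>\<^bsub>G\<^esub> w" for v w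
    proof -
      have "v \<in> verts G" using that by (rule adj_in_verts)
      from relpow_Least_step[OF reach[OF this] that] show ?thesis by (simp add: l_def d_def)
    qed
    define m where "m = Max (l ` verts G)"
    have layers: "l ` verts G = {1..m}"
      unfolding m_def
    proof (rule finite_downward_closed_eq_atLeastAtMost)
      fix i assume "0 < i" "Suc i \<in> l ` verts G"
      then obtain j v where "v \<in> verts G" "d v = Suc j" "i = Suc j"
        by (auto simp: l_def gr0_conv_Suc)
      with relpow_Least_pred[OF reach, of v j] obtain u where "u \<rightarrow>\<^bsub>G\<^esub> v" "l u = i"
        by (auto simp: l_def d_def)
      then show "i \<in> l ` verts G" using adj_in_verts by blast
    qed (use x in \<open>auto simp: l_def\<close>)
    have degree: "\<delta> \<le> card {w \<in> verts G. l w \<in> {l v - 1..Suc (l v)} \<and> c w \<noteq> c v}"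
      if v: "v \<in> verts G" for v
    proof -
      have "\<delta> \<le> out_degree G v"
        using assms(7) v unfolding min_degree_def by (auto intro: order_trans[OF _ Min_le])
      also have "\<dots> \<le> card {w \<in> verts G. l w \<in> {l v - 1..Suc (l v)} \<and> c w \<noteq> c v}"
        unfolding out_degree_eq_card_neighbors
      proof (intro card_mono subsetI)
        fix w assume "w \<in> {w. v \<rightarrow>\<^bsub>G\<^esub> w}"
        then have "v \<rightarrow>\<^bsub>G\<^esub> w" "w \<rightarrow>\<^bsub>G\<^esub> v" using arcs_ends_symmetric[OF sym_arcs] by simp_all
        with step[of v w] step[of w v] c(2)[of w v] adj_in_verts
        show "w \<in> {w \<in> verts G. l w \<in> {l v - 1..Suc (l v)} \<and> c w \<noteq> c v}" by auto
      qed auto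
      finally show ?thesis .
    qed
    have "real m * \<delta> \<le> (3 - 2 / k) * n"
      using layered_coloring_bound[OF finite_verts _ _ c(1) layers degree] assms(1,5) by simp
    moreover have "l y \<le> m" using layers y by auto
    then have "(d y + 1) * real \<delta> \<le> m * real \<delta>" unfolding l_def by (intro mult_right_mono) auto
    ultimately have bound: "d y \<le> (3 - 2 / real k) * (real n / real \<delta>) - 1"
      using assms(6) by (simp add: field_simps)
    have "(x, y) \<in> ?R ^^ d y"
      unfolding d_def using reach[OF y] by (metis LeastI rtrancl_imp_relpow)
    then obtain p where p: "awalk x p y" "length p = d y"
      using relpow_arcs_ends_imp_awalk x by blast
    have "graph_dist G x y \<le> awalk_cost (\<lambda>_. 1) p"
      unfolding graph_dist_def using p(1) by (rule min_cost_le_walk_cost)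
    also have "awalk_cost (\<lambda>_. 1) p = d y"
      using p(2) by (simp add: awalk_cost_def sum_list_triv)
    finally show ?thesis using bound by (meson ereal_less_eq(3) order_trans)
  qed
  then show ?thesis unfolding graph_diam_def by (auto intro: SUP_least)
qed

end
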